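(* If $T_x$ is a rooted tree, then $\chi_D(T_x)\le D(T_x)+1$.
   Context: A rooted tree $T_x$ is a tree with distinguished root $x$; its automorphisms are the tree automorphisms fixing $x$. A coloring is distinguishing if no nontrivial automorphism preserves all vertex colors, and proper if adjacent vertices receive different colors. $D(T_x)$ is the minimum number of colors in a distinguishing coloring of $T_x$, and $\chi_D(T_x)$ is the minimum number of colors in a proper distinguishing coloring of $T_x$. *)

theory Defs
  imports "Graph_Theory.Digraph_Component" "HOL-Library.Extended_Nat"
begin

text \<open>
  A simple graph, finite or infinite, is a symmetric loop-free digraph without parallel arcs
  (locale \<^locale>\<open>pair_bidirected_digraph\<close>). The library predicate \<^const>\<open>tree\<close> cannot be used for such
  graphs: in a symmetric digraph every edge \<open>uv\<close> yields the cycle \<open>u, v, u\<close>, so no graph with an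
  edge would be a tree. The cycles of the underlying undirected graph are the cycles with at least
  three arcs.
\<close>

locale rooted_tree = pair_bidirected_digraph T for T :: "'a pair_pre_digraph" +
  fixes x :: 'a
  assumes root_in_verts: "x \<in> pverts T"
    and tree_connected: "connected (with_proj T)"
    and tree_acyclic: "\<not> (\<exists>p. cycle p \<and> 3 \<le> length p)"

text \<open>Only the values of an automorphism on \<^term>\<open>pverts T\<close> matter.\<close>

definition rooted_automorphism :: "'a pair_pre_digraph \<Rightarrow> 'a \<Rightarrow> ('a \<Rightarrow> 'a) \<Rightarrow> bool" where
  "rooted_automorphism T x \<phi> \<longleftrightarrow>
     bij_betw \<phi> (pverts T) (pverts T) \<and>
     (\<forall>u\<in>pverts T. \<forall>v\<in>pverts T. (u, v) \<in> parcs T \<longleftrightarrow> (\<phi> u, \<phi> v) \<in> parcs T) \<and>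
     \<phi> x = x"

definition distinguishing :: "'a pair_pre_digraph \<Rightarrow> 'a \<Rightarrow> ('a \<Rightarrow> nat) \<Rightarrow> bool" where
  "distinguishing T x c \<longleftrightarrow>
     (\<forall>\<phi>. rooted_automorphism T x \<phi> \<and> (\<forall>v\<in>pverts T. c (\<phi> v) = c v)
        \<longrightarrow> (\<forall>v\<in>pverts T. \<phi> v = v))"

definition proper :: "'a pair_pre_digraph \<Rightarrow> ('a \<Rightarrow> nat) \<Rightarrow> bool" where
  "proper T c \<longleftrightarrow> (\<forall>(u, v)\<in>parcs T. c u \<noteq> c v)"

definition num_colors :: "'a pair_pre_digraph \<Rightarrow> ('a \<Rightarrow> nat) \<Rightarrow> enat" where
  "num_colors T c = (if finite (c ` pverts T) then enat (card (c ` pverts T)) else \<infinity>)"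

text \<open>
  The minimum number of colors is taken in \<^typ>\<open>enat\<close>; it is \<open>\<infinity>\<close> iff no finite number of colors
  suffices, which cannot happen for a finite tree (see \<open>chromatic_numbers_attained\<close> below).
\<close>

definition distinguishing_number :: "'a pair_pre_digraph \<Rightarrow> 'a \<Rightarrow> enat" where
  "distinguishing_number T x = (INF c\<in>{c. distinguishing T x c}. num_colors T c)"

definition distinguishing_chromatic_number :: "'a pair_pre_digraph \<Rightarrow> 'a \<Rightarrow> enat" where
  "distinguishing_chromatic_number T x =
     (INF c\<in>{c. proper T c \<and> distinguishing T x c}. num_colors T c)"

lemma enat_INF_attained:
  fixes f :: "'b \<Rightarrow> enat"
  assumes "S \<noteq> {}"
  shows "\<exists>s\<in>S. f s = (INF s\<in>S. f s)"
proof -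
  have "(LEAST y. y \<in> f ` S) \<in> f ` S"
    using assms by (metis LeastI all_not_in_conv image_is_empty)
  moreover have "(INF s\<in>S. f s) = (LEAST y. y \<in> f ` S)"
    using assms by (auto simp: Inf_enat_def)
  ultimately show ?thesis by auto
qed

lemma (in rooted_tree) chromatic_numbers_attained:
  assumes "finite (pverts T)"
  shows "\<exists>c. distinguishing T x c \<and> enat (card (c ` pverts T)) = distinguishing_number T x"
    and "\<exists>c. proper T c \<and> distinguishing T x c \<and>
             enat (card (c ` pverts T)) = distinguishing_chromatic_number T x"
proof -
  obtain c :: "'a \<Rightarrow> nat" where c: "inj_on c (pverts T)"
    using finite_imp_inj_to_nat_seg[OF assms] by auto
  have "distinguishing T x c"
    unfolding distinguishing_def rooted_automorphism_def
    using c by (meson bij_betwE inj_onD)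
  moreover have "proper T c"
    unfolding proper_def using c wellformed' pair_no_loops by (fastforce dest: inj_onD)
  ultimately have
    "{c. distinguishing T x c} \<noteq> {}" "{c. proper T c \<and> distinguishing T x c} \<noteq> {}"
    by auto
  from this[THEN enat_INF_attained, of "num_colors T"] assms
  show "\<exists>c. distinguishing T x c \<and> enat (card (c ` pverts T)) = distinguishing_number T x"
    and "\<exists>c. proper T c \<and> distinguishing T x c \<and>
             enat (card (c ` pverts T)) = distinguishing_chromatic_number T x"
    unfolding distinguishing_number_def distinguishing_chromatic_number_def
    by (auto simp: num_colors_def)
qed

end

theory Submission
  imports Defs "HOL-Number_Theory.Cong"
begin

text \<open>
  Let \<open>c\<close> be a distinguishing coloring with values in \<open>{..<k}\<close>. Put \<open>c' x = 0\<close> and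
  \<open>c' v = c' (parent v) + 1 + c v\<close> modulo \<open>k + 1\<close>. Adjacent vertices differ by an element of
  \<open>{1..k}\<close> modulo \<open>k + 1\<close>, so \<open>c'\<close> is proper. An automorphism fixing the root commutes with
  \<open>parent\<close>, and \<open>c v\<close> can be read off from \<open>c' v\<close> and \<open>c' (parent v)\<close>, so an automorphism preserving
  \<open>c'\<close> preserves \<open>c\<close> and is therefore trivial.
\<close>

context rooted_tree
begin

section \<open>Distance from the root\<close>

definition depth :: "'a \<Rightarrow> nat" where
  "depth v = (LEAST n. (x, v) \<in> parcs T ^^ n)"

text \<open>The weak inequality lets uniqueness of such a neighbour also exclude arcs between
  vertices of equal depth. At the root no neighbour qualifies, so \<open>parent x\<close> is
  arbitrary.\<close>

definition parent :: "'a \<Rightarrow> 'a" where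
  "parent v = (SOME u. (u, v) \<in> parcs T \<and> depth u \<le> depth v)"

lemma arc_sym: "(u, v) \<in> parcs T \<Longrightarrow> (v, u) \<in> parcs T"
  using pair_sym_arcs by (auto simp: symmetric_def sym_def)

lemma relpow_depth:
  assumes "v \<in> pverts T"
  shows "(x, v) \<in> parcs T ^^ depth v"
proof -
  have "strongly_connected (with_proj T)"
    using symmetric_connected_imp_strongly_connected tree_connected sym_arcs by auto
  then have "x \<rightarrow>\<^sup>*\<^bsub>with_proj T\<^esub> v"
    using assms root_in_verts by (auto simp: strongly_connected_def)
  then have "(x, v) \<in> (parcs T)\<^sup>*"
    by (auto simp: reachable_def dest: rtrancl_on_rtranclI)
  then obtain n where "(x, v) \<in> parcs T ^^ n"
    using rtrancl_imp_relpow by blast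
  then show ?thesis
    unfolding depth_def by (rule LeastI)
qed

lemma depth_root: "depth x = 0"
  unfolding depth_def by (rule Least_eq_0) simp

lemma depth_eq_0D: "v \<in> pverts T \<Longrightarrow> depth v = 0 \<Longrightarrow> v = x"
  using relpow_depth[of v] by simp

lemma depth_arc_le:
  assumes "(u, v) \<in> parcs T"
  shows "depth v \<le> Suc (depth u)"
proof -
  have "(x, u) \<in> parcs T ^^ depth u"
    using assms wellformed' by (auto intro: relpow_depth)
  with assms have "(x, v) \<in> parcs T ^^ Suc (depth u)"
    by auto
  then show ?thesis
    unfolding depth_def by (rule Least_le)
qed

lemma depth_SucE:
  assumes "v \<in> pverts T" "v \<noteq> x"
  obtains u where "(u, v) \<in> parcs T" "depth v = Suc (depth u)"
proof -
  obtain n where n: "depth v = Suc n"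
    using assms depth_eq_0D by (cases "depth v") auto
  with relpow_depth[OF assms(1)] obtain u where u: "(x, u) \<in> parcs T ^^ n" "(u, v) \<in> parcs T"
    by auto
  have "depth u \<le> n"
    unfolding depth_def using u(1) by (rule Least_le)
  with depth_arc_le[OF u(2)] n have "depth v = Suc (depth u)"
    by simp
  with u(2) show thesis
    by (rule that)
qed

section \<open>Uniqueness of the parent\<close>

text \<open>A shortest path from the root to \<open>u\<close> meets only vertices shallower than
  \<open>u\<close> before its end, hence never \<open>v\<close>. The induction follows it
  backwards.\<close>

lemma root_path_avoiding:
  assumes "u \<in> pverts T" "depth u \<le> depth v" "u \<noteq> v"
  shows "(x, u) \<in> (Restr (parcs T) (- {v}))\<^sup>*"
  using assms
proof (induction "depth u" arbitrary: u)
  case 0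
  then show ?case
    using depth_eq_0D by auto
next
  case (Suc n)
  then have "u \<noteq> x"
    using depth_root by auto
  then obtain w where w: "(w, u) \<in> parcs T" "depth u = Suc (depth w)"
    using Suc.prems(1) by (auto elim: depth_SucE)
  then have "w \<noteq> v"
    using Suc.prems by auto
  with w Suc have "(x, w) \<in> (Restr (parcs T) (- {v}))\<^sup>*"
    using wellformed'[OF w(1)] by auto
  moreover have "(w, u) \<in> Restr (parcs T) (- {v})"
    using w Suc.prems by auto
  ultimately show ?case
    by (rule rtrancl_into_rtrancl)
qed

text \<open>Otherwise a path from \<open>u\<close> to \<open>w\<close> off \<open>v\<close> closes
  up through \<open>v\<close> to a cycle, which has at least three arcs because the path is
  nonempty.\<close>

lemma neighbours_separated:
  assumes v: "(u, v) \<in> parcs T" "(w, v) \<in> parcs T"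
    and conn: "(u, w) \<in> (Restr (parcs T) (- {v}))\<^sup>*"
  shows "u = w"
proof (rule ccontr)
  assume "u \<noteq> w"
  have uV: "u \<in> pverts T" "u \<noteq> v" and wv: "w \<noteq> v"
    using v wellformed' pair_no_loops by fastforce+
  have "\<exists>p. awalk u p w \<and> set p \<subseteq> Restr (parcs T) (- {v})"
    using conn
  proof induction
    case base
    show ?case
      using uV by (intro exI[of _ "[]"]) (simp add: awalk_Nil_iff)
  next
    case (step y z)
    then obtain p where p: "awalk u p y" "set p \<subseteq> Restr (parcs T) (- {v})"
      by auto
    have "awalk y [(y, z)] z"
      using step(2) wellformed' by (auto simp: awalk_def)
    with p step(2) show ?case
      by (intro exI[of _ "p @ [(y, z)]"]) (auto intro: awalk_appendI)
  qed
  then obtain p where p: "awalk u p w" "set p \<subseteq> Restr (parcs T) (- {v})"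
    by auto
  \<comment> \<open>\<open>cycle\<close> demands distinct vertices, so the walk is cut down to a
    path; its arcs are among those of \<open>p\<close> and still avoid \<open>v\<close>.\<close>
  define q where "q = awalk_to_apath p"
  have q: "awalk u q w" "distinct (awalk_verts u q)" "set q \<subseteq> Restr (parcs T) (- {v})"
    using apath_awalk_to_apath[OF p(1)] awalk_to_apath_subset[OF p(1)] p(2)
    unfolding q_def apath_def by auto
  have "v \<notin> set (awalk_verts u q)"
    using q uV by (auto simp: set_awalk_verts)
  have "q \<noteq> []"
    using q(1) \<open>u \<noteq> w\<close> by (auto simp: awalk_Nil_iff)
  define r where "r = (v, u) # q @ [(w, v)]"
  have qv: "awalk u (q @ [(w, v)]) v"
    using q(1) v(2) wellformed' by (intro awalk_appendI) (auto simp: awalk_def)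
  then have "awalk v r v"
    unfolding r_def using arc_sym[OF v(1)] wellformed' by (auto simp: awalk_Cons_iff)
  moreover have "awalk_verts u (q @ [(w, v)]) = awalk_verts u q @ [v]"
    using awalk_verts_append[OF qv] by simp
  then have "distinct (tl (awalk_verts v r))"
    unfolding r_def using q(2) \<open>v \<notin> set (awalk_verts u q)\<close> by simp
  ultimately have "cycle r"
    unfolding cycle_def r_def by blast
  moreover have "3 \<le> length r"
    unfolding r_def using \<open>q \<noteq> []\<close> by (cases q) auto
  ultimately show False
    using tree_acyclic by blast
qed

text \<open>Both neighbours are linked to the root off \<open>v\<close>, hence by symmetry to each
  other.\<close>

lemma shallow_neighbour_unique:
  assumes "(u, v) \<in> parcs T" "depth u \<le> depth v" "(w, v) \<in> parcs T" "depth w \<le> depth v"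
  shows "u = w"
proof -
  let ?R = "Restr (parcs T) (- {v})"
  have "u \<in> pverts T" "w \<in> pverts T" "u \<noteq> v" "w \<noteq> v"
    using assms wellformed' pair_no_loops by fastforce+
  then have u: "(x, u) \<in> ?R\<^sup>*" and w: "(x, w) \<in> ?R\<^sup>*"
    using assms by (auto intro: root_path_avoiding)
  have "sym (?R\<^sup>*)"
    by (rule sym_rtrancl) (auto intro!: symI dest: arc_sym)
  then have "(u, x) \<in> ?R\<^sup>*"
    using u by (rule symD)
  with w have "(u, w) \<in> ?R\<^sup>*"
    by auto
  then show ?thesis
    using assms by (intro neighbours_separated)
qed

lemma parent_eqI:
  assumes "(u, v) \<in> parcs T" "depth u \<le> depth v"
  shows "parent v = u"
  unfolding parent_def using assms by (blast intro: shallow_neighbour_unique)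

lemma
  assumes "v \<in> pverts T" "v \<noteq> x"
  shows parent_arc: "(parent v, v) \<in> parcs T"
    and depth_parent: "depth v = Suc (depth (parent v))"
proof -
  obtain u where u: "(u, v) \<in> parcs T" "depth v = Suc (depth u)"
    using assms by (rule depth_SucE)
  then have "parent v = u"
    by (simp add: parent_eqI)
  with u show "(parent v, v) \<in> parcs T" "depth v = Suc (depth (parent v))"
    by simp_all
qed

lemma arc_parent_cases:
  assumes "(u, v) \<in> parcs T"
  obtains (down) "v \<noteq> x" "parent v = u" | (up) "u \<noteq> x" "parent u = v"
proof -
  have aux: "b \<noteq> x \<and> parent b = a" if "(a, b) \<in> parcs T" "depth a \<le> depth b" for a b
  proof
    show "parent b = a"
      using that by (rule parent_eqI)
    have "a \<in> pverts T" "a \<noteq> b"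
      using that(1) wellformed' pair_no_loops by fastforce+
    \<comment> \<open>If \<open>b\<close> were the root, \<open>a\<close> would have depth 0 and the
      arc would be a loop.\<close>
    then show "b \<noteq> x"
      using that(2) depth_root depth_eq_0D by auto
  qed
  show thesis
  proof (cases "depth u \<le> depth v")
    case True
    then show thesis
      using aux[OF assms] down by blast
  next
    case False
    then show thesis
      using aux[OF arc_sym[OF assms]] up by auto
  qed
qed

section \<open>Automorphisms and parents\<close>

text \<open>The image of the arc from \<open>parent v\<close> to \<open>v\<close> again joins a
  vertex to its parent; induction on depth excludes that it is turned upside down.\<close>

lemma automorphism_commutes_parent:
  assumes aut: "rooted_automorphism T x \<phi>"
    and "v \<in> pverts T" "v \<noteq> x"
  shows "\<phi> (parent v) = parent (\<phi> v)"
  using assms(2,3)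
proof (induction "depth v" arbitrary: v rule: less_induct)
  case less
  have inj: "inj_on \<phi> (pverts T)" and "\<phi> x = x"
    using aut by (auto simp: rooted_automorphism_def bij_betw_def)
  let ?u = "parent v"
  have arc: "(?u, v) \<in> parcs T" and dep: "depth v = Suc (depth ?u)"
    using less.prems by (auto intro: parent_arc depth_parent)
  have uV: "?u \<in> pverts T"
    using arc wellformed' by auto
  have "(\<phi> ?u, \<phi> v) \<in> parcs T"
    using arc aut uV less.prems by (simp add: rooted_automorphism_def)
  then show ?case
  proof (cases rule: arc_parent_cases)
    case down
    then show ?thesis
      by simp
  next
    \<comment> \<open>Here \<open>\<phi> v\<close> is the parent of \<open>\<phi> ?u\<close>. The
      induction hypothesis at \<open>?u\<close> and injectivity make \<open>v\<close> the parent of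
      its own parent, against the depths.\<close>
    case up
    then have "?u \<noteq> x"
      using \<open>\<phi> x = x\<close> by auto
    then have "parent ?u \<in> pverts T" "depth ?u = Suc (depth (parent ?u))"
      using parent_arc[OF uV] wellformed' depth_parent[OF uV] by auto
    moreover have "\<phi> (parent ?u) = \<phi> v"
      using less.hyps[OF _ uV \<open>?u \<noteq> x\<close>] dep up by simp
    ultimately have "parent ?u = v"
      using inj less.prems by (auto dest: inj_onD)
    with dep \<open>depth ?u = _\<close> show ?thesis
      by simp
  qed
qed

section \<open>The proper recoloring\<close>

text \<open>The level counter, later set to \<open>depth v\<close>, makes the recursion along
  \<open>parent\<close> primitive.\<close>

primrec level_color :: "nat \<Rightarrow> ('a \<Rightarrow> nat) \<Rightarrow> nat \<Rightarrow> 'a \<Rightarrow> nat" where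
  "level_color k c 0 v = 0"
| "level_color k c (Suc n) v = (level_color k c n (parent v) + 1 + c v) mod Suc k"

definition recolor :: "nat \<Rightarrow> ('a \<Rightarrow> nat) \<Rightarrow> 'a \<Rightarrow> nat" where
  "recolor k c v = level_color k c (depth v) v"

lemma recolor_parent:
  assumes "v \<in> pverts T" "v \<noteq> x"
  shows "recolor k c v = (recolor k c (parent v) + 1 + c v) mod Suc k"
  unfolding recolor_def by (simp add: depth_parent[OF assms])

lemma recolor_le: "recolor k c v \<le> k"
  unfolding recolor_def by (cases "depth v") (simp_all add: mod_Suc_le_divisor)

lemma recolor_neq_parent:
  assumes "v \<in> pverts T" "v \<noteq> x" "c v < k"
  shows "recolor k c v \<noteq> recolor k c (parent v)"
proof
  assume "recolor k c v = recolor k c (parent v)"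
  \<comment> \<open>The right-hand reduction changes nothing, as colors are at most
    \<open>k\<close>; it yields a congruence from which the increment is isolated.\<close>
  then have "(recolor k c (parent v) + Suc (c v)) mod Suc k = recolor k c (parent v) mod Suc k"
    using recolor_parent[OF assms(1,2)] recolor_le[of k c "parent v"] by simp
  then have "Suc k dvd Suc (c v)"
    by (metis add_diff_cancel_left' le_add1 mod_eq_dvd_iff_nat)
  with assms(3) show False
    by (auto dest: dvd_imp_le)
qed

lemma proper_recolor:
  assumes "\<And>v. v \<in> pverts T \<Longrightarrow> c v < k"
  shows "proper T (recolor k c)"
  unfolding proper_def
proof clarify
  fix u v
  assume arc: "(u, v) \<in> parcs T" and eq: "recolor k c u = recolor k c v"
  have "u \<in> pverts T" "v \<in> pverts T"
    using arc wellformed' by auto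
  from arc show False
    using recolor_neq_parent[of u c k] recolor_neq_parent[of v c k] assms eq
      \<open>u \<in> pverts T\<close> \<open>v \<in> pverts T\<close>
    by (cases rule: arc_parent_cases) auto
qed

lemma distinguishing_recolor:
  assumes lt: "\<And>v. v \<in> pverts T \<Longrightarrow> c v < k" and c: "distinguishing T x c"
  shows "distinguishing T x (recolor k c)"
  unfolding distinguishing_def
proof (intro allI impI, elim conjE)
  fix \<phi>
  assume aut: "rooted_automorphism T x \<phi>"
    and pres: "\<forall>v\<in>pverts T. recolor k c (\<phi> v) = recolor k c v"
  have inj: "inj_on \<phi> (pverts T)" and root: "\<phi> x = x"
    and im: "\<And>v. v \<in> pverts T \<Longrightarrow> \<phi> v \<in> pverts T"
    using aut by (auto simp: rooted_automorphism_def bij_betw_def)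
  have "c (\<phi> v) = c v" if v: "v \<in> pverts T" for v
  proof (cases "v = x")
    case True
    then show ?thesis
      using root by simp
  next
    case False
    have "\<phi> v \<noteq> x"
      using False inj root v root_in_verts by (metis inj_onD)
    have "parent v \<in> pverts T"
      using parent_arc[OF v False] wellformed' by auto
    define a where "a = recolor k c (parent v) + 1"
    have "recolor k c (parent (\<phi> v)) = recolor k c (parent v)"
      using pres \<open>parent v \<in> pverts T\<close> automorphism_commutes_parent[OF aut v False] by metis
    then have "(a + c (\<phi> v)) mod Suc k = (a + c v) mod Suc k"
      using recolor_parent[OF v False, of k c] recolor_parent[OF im[OF v] \<open>\<phi> v \<noteq> x\<close>, of k c] pres v
      unfolding a_def by simp
    \<comment> \<open>Once \<open>a\<close> is cancelled, congruence is equality because both colors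
      are below \<open>k\<close>.\<close>
    then have "c (\<phi> v) mod Suc k = c v mod Suc k"
      by (meson cong_def cong_add_lcancel_nat)
    then show ?thesis
      using lt[OF v] lt[OF im[OF v]] by simp
  qed
  with aut c show "\<forall>v\<in>pverts T. \<phi> v = v"
    unfolding distinguishing_def by blast
qed

section \<open>Counting colors\<close>

text \<open>Injectivity on the colors in use lets them be renumbered as \<open>0..<k\<close>, the
  range that the recoloring requires.\<close>

lemma distinguishing_comp:
  assumes "distinguishing T x c" "inj_on h (c ` pverts T)"
  shows "distinguishing T x (h \<circ> c)"
  unfolding distinguishing_def
proof (intro allI impI, elim conjE)
  fix \<phi>
  assume aut: "rooted_automorphism T x \<phi>"
    and pres: "\<forall>v\<in>pverts T. (h \<circ> c) (\<phi> v) = (h \<circ> c) v"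
  have "\<And>v. v \<in> pverts T \<Longrightarrow> \<phi> v \<in> pverts T"
    using aut by (auto simp: rooted_automorphism_def bij_betw_def)
  then have "\<forall>v\<in>pverts T. c (\<phi> v) = c v"
    using pres assms(2) by (auto dest: inj_onD)
  with aut assms(1) show "\<forall>v\<in>pverts T. \<phi> v = v"
    unfolding distinguishing_def by blast
qed

lemma distinguishing_chromatic_number_le:
  assumes c: "distinguishing T x c"
  shows "distinguishing_chromatic_number T x \<le> num_colors T c + 1"
proof (cases "finite (c ` pverts T)")
  case False
  then show ?thesis
    by (simp add: num_colors_def)
next
  case True
  define k where "k = card (c ` pverts T)"
  obtain h where h: "bij_betw h (c ` pverts T) {0..<k}"
    using ex_bij_betw_finite_nat[OF True] unfolding k_def by blast
  let ?c = "recolor k (h \<circ> c)"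
  have lt: "\<And>v. v \<in> pverts T \<Longrightarrow> (h \<circ> c) v < k"
    using h by (auto simp: bij_betw_def)
  have "distinguishing T x (h \<circ> c)"
    using c h by (auto intro: distinguishing_comp simp: bij_betw_def)
  then have "proper T ?c" "distinguishing T x ?c"
    using lt by (auto intro: proper_recolor distinguishing_recolor)
  then have "distinguishing_chromatic_number T x \<le> num_colors T ?c"
    unfolding distinguishing_chromatic_number_def by (intro INF_lower) simp
  also have "\<dots> \<le> enat (Suc k)"
  proof -
    have sub: "?c ` pverts T \<subseteq> {..k}"
      using recolor_le by auto
    then have "card (?c ` pverts T) \<le> Suc k"
      using card_mono[OF _ sub] by simp
    with sub show ?thesis
      by (auto simp: num_colors_def intro: finite_subset)
  qed
  also have "\<dots> = num_colors T c + 1"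
    using True by (simp add: num_colors_def k_def one_enat_def)
  finally show ?thesis .
qed

end

theorem theorem12:
  fixes T :: "'a pair_pre_digraph" and x :: 'a
  assumes "rooted_tree T x"
  shows "distinguishing_chromatic_number T x \<le> distinguishing_number T x + 1"
proof (cases "{c. distinguishing T x c} = {}")
  \<comment> \<open>An infinite tree may admit no distinguishing coloring by naturals; the infimum
    is then \<infinity>.\<close>
  case True
  then show ?thesis
    by (simp add: distinguishing_number_def top_enat_def)
next
  case False
  then obtain c where "distinguishing T x c" "num_colors T c = distinguishing_number T x"
    using enat_INF_attained[OF False, of "num_colors T"]
    unfolding distinguishing_number_def by auto
  then show ?thesis
    using rooted_tree.distinguishing_chromatic_number_le[OF assms] by metis
qed

end
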